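(* Let $d\ge2$, let $\mathbb R^d$ carry the Euclidean metric $g=\langle\cdot,\cdot\rangle$, let $C$ be a nonzero totally symmetric trilinear form on $\mathbb R^d$ with constant coefficients, let $K$ be the constant symmetric bilinear map with $\langle K(X,Y),Z\rangle=C(X,Y,Z)$, and set $\nabla:=\nabla^E+K$, $\nabla^*:=\nabla^E-K$, where $\nabla^E=\nabla^g$ is the flat Euclidean connection. Then: (i) $\nabla$ and $\nabla^*$ are torsion-free and $g$-dual to each other, and they are flat if and only if $[K_X,K_Y]=0$ for all $X,Y\in\mathbb R^d$, where $K_X:=K(X,\cdot)$. For every $d\ge2$ there exists such a $C$ for which $\nabla$ is not flat. (ii) There exists $\rho>0$, depending only on $C$, such that for all $P,Q\in\mathbb R^d$ with $0<\|P-Q\|<\rho$, with $o:=\frac{P+Q}2$ and $\delta:=\|P-Q\|$, for each $D\in\{\nabla,\nabla^*\}$ there is a unique affinely parametrized $D$-geodesic $\gamma:[0,1]\to\mathbb R^d$ from $P$ to $Q$ that remains in the open ball $B_\delta(o)$. Denoting by $A(P,Q)$ and $M(P,Q)$ the points $\gamma(1/2)$ for $D=\nabla$ and $D=\nabla^*$ respectively, one has $$A(P,Q)+M(P,Q)=P+Q .$$ (iii) There exists $\varepsilon>0$ such that for all $P,Q\in\mathbb R^d$ with $\|P-Q\|<\varepsilon$ the iteration $(P_0,Q_0)=(P,Q)$, $(P_{n+1},Q_{n+1})=(A(P_n,Q_n),M(P_n,Q_n))$ is well defined and converges quadratically, in the sense that $\|P_{n+1}-Q_{n+1}\|\le c\,\|P_n-Q_n\|^2$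 for all $n$ with a constant $c$ independent of $P,Q$, and $$(A\otimes M)(P,Q)=\frac{P+Q}{2}=M_g(P,Q).$$
   Context: The $g$-dual $\nabla^*$ of $\nabla$ is determined by $X[g(Y,Z)]=g(\nabla_XY,Z)+g(Y,\nabla^*_XZ)$. A connection is flat if it is curvature-free and torsion-free. $\nabla=\nabla^E+K$ means $\nabla_XY=\nabla^E_XY+K(X,Y)$. By convention $A(P,P)=M(P,P)=P$. $M_g(P,Q)=\frac{P+Q}{2}$ is the Levi--Civita midpoint. The Gauss composition $(A\otimes M)(P,Q)$ is the common limit of $(P_n)$ and $(Q_n)$. *)

theory Defs
  imports "HOL-Analysis.Analysis"
begin

section \<open>Vector fields and connections on a Euclidean space\<close>

text \<open>Differentiability of order \<open>k\<close> on the whole space: all iterated directional derivatives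
  up to order \<open>k - 1\<close> are (Frechet) differentiable and those of order \<open>k\<close> are continuous.\<close>

primrec times_cont_diff :: "nat \<Rightarrow> ('a::real_normed_vector \<Rightarrow> 'b::real_normed_vector) \<Rightarrow> bool" where
  "times_cont_diff 0 f \<longleftrightarrow> continuous_on UNIV f"
| "times_cont_diff (Suc k) f \<longleftrightarrow>
     f differentiable_on UNIV \<and> (\<forall>v. times_cont_diff k (\<lambda>p. frechet_derivative f (at p) v))"

definition smooth :: "('a::real_normed_vector \<Rightarrow> 'b::real_normed_vector) \<Rightarrow> bool" where
  "smooth f \<longleftrightarrow> (\<forall>k. times_cont_diff k f)"

definition dir_deriv ::
    "('a::real_normed_vector \<Rightarrow> 'a) \<Rightarrow> ('a \<Rightarrow> 'b::real_normed_vector) \<Rightarrow> 'a \<Rightarrow> 'b" where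
  "dir_deriv X f = (\<lambda>p. frechet_derivative f (at p) (X p))"

definition lie_bracket ::
    "('a::real_normed_vector \<Rightarrow> 'a) \<Rightarrow> ('a \<Rightarrow> 'a) \<Rightarrow> 'a \<Rightarrow> 'a" where
  "lie_bracket X Y = (\<lambda>p. dir_deriv X Y p - dir_deriv Y X p)"

text \<open>A connection is represented by the operator taking vector fields \<open>X\<close> and \<open>Y\<close> to the vector
  field \<open>\<nabla>\<^sub>X Y\<close>; only its values on smooth fields are meaningful.\<close>

type_synonym 'a connection = "('a \<Rightarrow> 'a) \<Rightarrow> ('a \<Rightarrow> 'a) \<Rightarrow> 'a \<Rightarrow> 'a"

definition euclidean_connection :: "'a::real_normed_vector connection" where
  "euclidean_connection X Y = dir_deriv X Y"

definition add_tensor ::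
    "'a::real_normed_vector connection \<Rightarrow> ('a \<Rightarrow> 'a \<Rightarrow> 'a) \<Rightarrow> 'a connection" where
  "add_tensor D K X Y = (\<lambda>p. D X Y p + K (X p) (Y p))"

definition torsion :: "'a::real_normed_vector connection \<Rightarrow> 'a connection" where
  "torsion D X Y = (\<lambda>p. D X Y p - D Y X p - lie_bracket X Y p)"

definition curvature ::
    "'a::real_normed_vector connection \<Rightarrow> ('a \<Rightarrow> 'a) \<Rightarrow> ('a \<Rightarrow> 'a) \<Rightarrow> ('a \<Rightarrow> 'a) \<Rightarrow> 'a \<Rightarrow> 'a" where
  "curvature D X Y Z = (\<lambda>p. D X (D Y Z) p - D Y (D X Z) p - D (lie_bracket X Y) Z p)"

definition torsion_free :: "'a::real_normed_vector connection \<Rightarrow> bool" where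
  "torsion_free D \<longleftrightarrow> (\<forall>X Y. smooth X \<longrightarrow> smooth Y \<longrightarrow> (\<forall>p. torsion D X Y p = 0))"

definition curvature_free :: "'a::real_normed_vector connection \<Rightarrow> bool" where
  "curvature_free D \<longleftrightarrow>
     (\<forall>X Y Z. smooth X \<longrightarrow> smooth Y \<longrightarrow> smooth Z \<longrightarrow> (\<forall>p. curvature D X Y Z p = 0))"

definition flat :: "'a::real_normed_vector connection \<Rightarrow> bool" where
  "flat D \<longleftrightarrow> curvature_free D \<and> torsion_free D"

text \<open>\<open>metric_dual D D'\<close>: the connection \<open>D'\<close> is the dual of \<open>D\<close> with respect to the Euclidean
  metric, i.e. \<open>X \<langle>Y, Z\<rangle> = \<langle>D\<^sub>X Y, Z\<rangle> + \<langle>Y, D'\<^sub>X Z\<rangle>\<close>.\<close>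

definition metric_dual :: "'a::real_inner connection \<Rightarrow> 'a connection \<Rightarrow> bool" where
  "metric_dual D D' \<longleftrightarrow>
     (\<forall>X Y Z. smooth X \<longrightarrow> smooth Y \<longrightarrow> smooth Z \<longrightarrow>
        (\<forall>p. dir_deriv X (\<lambda>q. Y q \<bullet> Z q) p = D X Y p \<bullet> Z p + Y p \<bullet> D' X Z p))"


section \<open>Geodesics and midpoints\<close>

text \<open>Christoffel symbols in the standard global chart: \<open>\<nabla>\<close> applied to constant fields.\<close>

definition christoffel :: "'a::real_normed_vector connection \<Rightarrow> 'a \<Rightarrow> 'a \<Rightarrow> 'a \<Rightarrow> 'a" where
  "christoffel D p u v = D (\<lambda>_. u) (\<lambda>_. v) p"

text \<open>The geodesic equation \<open>\<gamma>'' + \<Gamma>(\<gamma>', \<gamma>') = 0\<close> on \<open>[0,1]\<close>, with one-sided derivatives at the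
  end points.  Curves are required to be extensional, so that equality of curves is equality of
  maps defined on \<open>[0,1]\<close> only.\<close>

definition geodesic :: "'a::real_normed_vector connection \<Rightarrow> (real \<Rightarrow> 'a) \<Rightarrow> bool" where
  "geodesic D \<gamma> \<longleftrightarrow>
     \<gamma> \<in> extensional {0..1} \<and>
     (\<exists>\<gamma>' \<gamma>''. \<forall>t\<in>{0..1}.
        (\<gamma> has_vector_derivative \<gamma>' t) (at t within {0..1}) \<and>
        (\<gamma>' has_vector_derivative \<gamma>'' t) (at t within {0..1}) \<and>
        \<gamma>'' t + christoffel D (\<gamma> t) (\<gamma>' t) (\<gamma>' t) = 0)"

definition confined_geodesic ::
    "'a::real_normed_vector connection \<Rightarrow> 'a \<Rightarrow> 'a \<Rightarrow> (real \<Rightarrow> 'a) \<Rightarrow> bool" where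
  "confined_geodesic D P Q \<gamma> \<longleftrightarrow>
     geodesic D \<gamma> \<and> \<gamma> 0 = P \<and> \<gamma> 1 = Q \<and> \<gamma> ` {0..1} \<subseteq> ball (midpoint P Q) (norm (P - Q))"

definition geodesic_midpoint :: "'a::real_normed_vector connection \<Rightarrow> 'a \<Rightarrow> 'a \<Rightarrow> 'a" where
  "geodesic_midpoint D P Q = (if P = Q then P else (THE \<gamma>. confined_geodesic D P Q \<gamma>) (1 / 2))"

text \<open>The pairs at which \<^const>\<open>geodesic_midpoint\<close> is meaningful.\<close>

definition geodesic_midpoint_defined :: "'a::real_normed_vector connection \<Rightarrow> 'a \<Rightarrow> 'a \<Rightarrow> bool" where
  "geodesic_midpoint_defined D P Q \<longleftrightarrow> P = Q \<or> (\<exists>!\<gamma>. confined_geodesic D P Q \<gamma>)"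


section \<open>Gauss composition of two means\<close>

primrec gauss_iter :: "('a \<Rightarrow> 'a \<Rightarrow> 'a) \<Rightarrow> ('a \<Rightarrow> 'a \<Rightarrow> 'a) \<Rightarrow> 'a \<Rightarrow> 'a \<Rightarrow> nat \<Rightarrow> 'a \<times> 'a" where
  "gauss_iter A M P Q 0 = (P, Q)"
| "gauss_iter A M P Q (Suc n) = (case gauss_iter A M P Q n of (p, q) \<Rightarrow> (A p q, M p q))"

definition common_limit :: "(nat \<Rightarrow> 'a::topological_space \<times> 'a) \<Rightarrow> 'a \<Rightarrow> bool" where
  "common_limit S L \<longleftrightarrow> (\<lambda>n. fst (S n)) \<longlonglongrightarrow> L \<and> (\<lambda>n. snd (S n)) \<longlonglongrightarrow> L"

definition gauss_composition ::
    "('a::topological_space \<Rightarrow> 'a \<Rightarrow> 'a) \<Rightarrow> ('a \<Rightarrow> 'a \<Rightarrow> 'a) \<Rightarrow> 'a \<Rightarrow> 'a \<Rightarrow> 'a" where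
  "gauss_composition A M P Q = (THE L. common_limit (gauss_iter A M P Q) L)"


section \<open>Symmetric trilinear forms\<close>

definition trilinear :: "('a::real_vector \<Rightarrow> 'a \<Rightarrow> 'a \<Rightarrow> real) \<Rightarrow> bool" where
  "trilinear C \<longleftrightarrow> (\<forall>Y Z. linear (\<lambda>X. C X Y Z)) \<and> (\<forall>X Z. linear (\<lambda>Y. C X Y Z)) \<and>
     (\<forall>X Y. linear (\<lambda>Z. C X Y Z))"

definition totally_symmetric :: "('a \<Rightarrow> 'a \<Rightarrow> 'a \<Rightarrow> real) \<Rightarrow> bool" where
  "totally_symmetric C \<longleftrightarrow> (\<forall>X Y Z. C X Y Z = C Y X Z \<and> C X Y Z = C X Z Y)"

definition nonzero_cubic_form :: "('a::real_vector \<Rightarrow> 'a \<Rightarrow> 'a \<Rightarrow> real) \<Rightarrow> bool" where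
  "nonzero_cubic_form C \<longleftrightarrow> trilinear C \<and> totally_symmetric C \<and> (\<exists>X Y Z. C X Y Z \<noteq> 0)"

text \<open>The tensor \<open>K\<close> metrically equivalent to \<open>C\<close>, i.e. \<open>\<langle>K(X, Y), Z\<rangle> = C(X, Y, Z)\<close>; by
  nondegeneracy of the metric \<open>K\<close> is determined by \<open>C\<close>, and it inherits symmetry and bilinearity.\<close>

definition represents ::
    "('a::real_inner \<Rightarrow> 'a \<Rightarrow> 'a) \<Rightarrow> ('a \<Rightarrow> 'a \<Rightarrow> 'a \<Rightarrow> real) \<Rightarrow> bool" where
  "represents K C \<longleftrightarrow> (\<forall>X Y Z. K X Y \<bullet> Z = C X Y Z)"

definition commutator :: "('a::real_vector \<Rightarrow> 'a) \<Rightarrow> ('a \<Rightarrow> 'a) \<Rightarrow> 'a \<Rightarrow> 'a" where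
  "commutator S T = (\<lambda>v. S (T v) - T (S v))"

end

theory Submission
  imports Defs
begin

text \<open>
  Adding a constant tensor \<open>K\<close> to the flat derivative gives a connection whose Christoffel symbols
  are the constant \<open>K\<close>.  Torsion-freeness and duality then express only the symmetry of \<open>K\<close> and of
  the trilinear form \<open>\<langle>K(X, Y), Z\<rangle>\<close>.  In the curvature all derivative terms cancel, because
  second derivatives are symmetric, and only the commutator of \<open>K\<^sub>X\<close> and \<open>K\<^sub>Y\<close> remains
  (\<open>curvature_add_tensor\<close>).

  The geodesic equation is \<open>\<gamma>'' = - K(\<gamma>', \<gamma>')\<close>, quadratic in the velocity.  Let
  \<open>\<delta> = \<parallel>P - Q\<parallel>\<close> and \<open>k\<close> a bound for \<open>K\<close>.  Everything rests on the smallness of the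
  dimensionless quantity \<open>k\<delta>\<close>.
  \<^item> A curve confined to a ball of radius \<open>\<delta>\<close> whose acceleration is at most \<open>k\<close> times the square of
    its speed has speed at most \<open>8\<delta>\<close> (\<open>velocity_bound_of_confined\<close>): a curve that is
    fast at one instant keeps its velocity long enough to leave the ball.
  \<^item> If a function on \<open>[0,1]\<close> has equal values at the end points, then its velocity is bounded by
    its acceleration (\<open>velocity_le_acceleration\<close>).  Applied to the difference of two
    geodesics this gives uniqueness; applied to the difference of a geodesic and the chord it puts
    the midpoint of the geodesic within \<open>32k\<delta>\<^sup>2\<close> of \<open>(P + Q) / 2\<close>; and it makes the integral
    operator for the velocity a contraction, which gives existence.

  The point reflection in \<open>(P + Q) / 2\<close> combined with time reversal changes the sign of the
  acceleration but not the velocity.  It therefore takes the geodesic of one connection from \<open>P\<close> to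
  \<open>Q\<close> to the geodesic of the dual connection from \<open>P\<close> to \<open>Q\<close>
  (\<open>confined_geodesic_reflect\<close>), so the two midpoints add up to \<open>P + Q\<close>.  Hence the
  iteration preserves \<open>P\<^sub>n + Q\<^sub>n\<close>, the gap \<open>P\<^sub>n - Q\<^sub>n\<close> is replaced by one of order \<open>k\<close> times
  its square, and both sequences tend to half the preserved sum.
\<close>

section \<open>Symmetry of second derivatives\<close>

text \<open>Two applications of the mean value theorem to the alternating sum over a parallelogram.
  The left-hand side is symmetric in \<open>v\<close> and \<open>w\<close>, which is what yields the symmetry of the
  mixed derivatives.\<close>
lemma rectangle_mean_value:
  fixes g :: "'a::real_normed_vector \<Rightarrow> real"
  assumes G: "\<And>q. (g has_derivative G q) (at q)"
    and H: "\<And>q. ((\<lambda>r. G r v) has_derivative H q) (at q)"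
    and s: "0 < s"
  shows "\<exists>\<xi>\<in>{0<..<s}. \<exists>\<eta>\<in>{0<..<s}.
    g (p + s *\<^sub>R v + s *\<^sub>R w) - g (p + s *\<^sub>R v) - g (p + s *\<^sub>R w) + g p
      = s * s * H (p + \<xi> *\<^sub>R v + \<eta> *\<^sub>R w) w"
proof -
  have lin: "G q (c *\<^sub>R x) = c * G q x" "H q (c *\<^sub>R x) = c * H q x" for q c x
    using has_derivative_linear[OF G[of q]] has_derivative_linear[OF H[of q]]
    by (simp_all add: linear_cmul)
  define \<phi> where "\<phi> r = g (p + r *\<^sub>R v + s *\<^sub>R w) - g (p + r *\<^sub>R v)" for r
  have "(\<phi> has_real_derivative (G (p + r *\<^sub>R v + s *\<^sub>R w) v - G (p + r *\<^sub>R v) v)) (at r)" for r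
    unfolding \<phi>_def has_field_derivative_def
    by (rule has_derivative_eq_rhs,
        rule derivative_intros has_derivative_compose[OF _ G] | simp)+
       (auto simp: lin algebra_simps fun_eq_iff)
  then obtain \<xi> where \<xi>: "0 < \<xi>" "\<xi> < s"
    "\<phi> s - \<phi> 0 = s * (G (p + \<xi> *\<^sub>R v + s *\<^sub>R w) v - G (p + \<xi> *\<^sub>R v) v)"
    using MVT2[OF s, of \<phi> "\<lambda>r. G (p + r *\<^sub>R v + s *\<^sub>R w) v - G (p + r *\<^sub>R v) v"] by auto
  define \<psi> where "\<psi> r = G (p + \<xi> *\<^sub>R v + r *\<^sub>R w) v" for r
  have "(\<psi> has_real_derivative H (p + \<xi> *\<^sub>R v + r *\<^sub>R w) w) (at r)" for r
    unfolding \<psi>_def has_field_derivative_def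
    by (rule has_derivative_eq_rhs,
        rule derivative_intros has_derivative_compose[OF _ H] | simp)+
       (auto simp: lin algebra_simps fun_eq_iff)
  then obtain \<eta> where \<eta>: "0 < \<eta>" "\<eta> < s"
    "\<psi> s - \<psi> 0 = s * H (p + \<xi> *\<^sub>R v + \<eta> *\<^sub>R w) w"
    using MVT2[OF s, of \<psi> "\<lambda>r. H (p + \<xi> *\<^sub>R v + r *\<^sub>R w) w"] by auto
  show ?thesis
    using \<xi> \<eta> by (intro bexI[of _ \<xi>] bexI[of _ \<eta>]) (auto simp: \<phi>_def \<psi>_def)
qed

text \<open>Over a shrinking sequence of parallelograms the two mean value expressions for the same
  alternating sum agree, and by continuity they tend to the two mixed derivatives at \<open>p\<close>.\<close>
lemma second_derivative_symmetric_real: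
  fixes g :: "'a::real_normed_vector \<Rightarrow> real"
  assumes G: "\<And>q. (g has_derivative G q) (at q)"
    and Hv: "\<And>q. ((\<lambda>r. G r v) has_derivative Hv q) (at q)"
    and Hw: "\<And>q. ((\<lambda>r. G r w) has_derivative Hw q) (at q)"
    and cv: "isCont (\<lambda>q. Hv q w) p" and cw: "isCont (\<lambda>q. Hw q v) p"
  shows "Hv p w = Hw p v"
proof -
  define s where "s n = inverse (real (Suc n))" for n
  have s: "0 < s n" for n by (simp add: s_def)
  have s0: "s \<longlonglongrightarrow> 0" unfolding s_def by (rule LIMSEQ_inverse_real_of_nat)
  have "\<exists>a b c d. 0 < a \<and> a < s n \<and> 0 < b \<and> b < s n \<and> 0 < c \<and> c < s n \<and> 0 < d \<and> d < s n \<and>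
     Hv (p + a *\<^sub>R v + b *\<^sub>R w) w = Hw (p + c *\<^sub>R w + d *\<^sub>R v) v" for n
  proof -
    obtain a b where ab: "0 < a" "a < s n" "0 < b" "b < s n"
      "g (p + s n *\<^sub>R v + s n *\<^sub>R w) - g (p + s n *\<^sub>R v) - g (p + s n *\<^sub>R w) + g p
        = s n * s n * Hv (p + a *\<^sub>R v + b *\<^sub>R w) w"
      using rectangle_mean_value[OF G Hv s, of n p w] by auto
    obtain c d where cd: "0 < c" "c < s n" "0 < d" "d < s n"
      "g (p + s n *\<^sub>R w + s n *\<^sub>R v) - g (p + s n *\<^sub>R w) - g (p + s n *\<^sub>R v) + g p
        = s n * s n * Hw (p + c *\<^sub>R w + d *\<^sub>R v) v"
      using rectangle_mean_value[OF G Hw s, of n p v] by auto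
    have "p + s n *\<^sub>R w + s n *\<^sub>R v = p + s n *\<^sub>R v + s n *\<^sub>R w" by simp
    with ab(5) cd(5)[unfolded this] have "s n * s n * Hv (p + a *\<^sub>R v + b *\<^sub>R w) w = s n * s n * Hw (p + c *\<^sub>R w + d *\<^sub>R v) v"
      by linarith
    with s[of n] have "Hv (p + a *\<^sub>R v + b *\<^sub>R w) w = Hw (p + c *\<^sub>R w + d *\<^sub>R v) v" by simp
    with ab cd show ?thesis by blast
  qed
  then obtain a b c d where B: "\<And>n. 0 < a n" "\<And>n. a n < s n" "\<And>n. 0 < b n" "\<And>n. b n < s n"
      "\<And>n. 0 < c n" "\<And>n. c n < s n" "\<And>n. 0 < d n" "\<And>n. d n < s n"
    and E: "\<And>n. Hv (p + a n *\<^sub>R v + b n *\<^sub>R w) w = Hw (p + c n *\<^sub>R w + d n *\<^sub>R v) v"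
    by metis
  have z: "x \<longlonglongrightarrow> 0" if "\<And>n. 0 < x n" "\<And>n. x n < s n" for x
    by (rule tendsto_sandwich[OF _ _ tendsto_const s0])
       (intro always_eventually allI less_imp_le that)+
  have "(\<lambda>n. p + a n *\<^sub>R v + b n *\<^sub>R w) \<longlonglongrightarrow> p + 0 *\<^sub>R v + 0 *\<^sub>R w"
    by (intro tendsto_intros z B)
  then have 1: "(\<lambda>n. Hv (p + a n *\<^sub>R v + b n *\<^sub>R w) w) \<longlonglongrightarrow> Hv p w"
    using isCont_tendsto_compose[OF cv] by simp
  have "(\<lambda>n. p + c n *\<^sub>R w + d n *\<^sub>R v) \<longlonglongrightarrow> p + 0 *\<^sub>R w + 0 *\<^sub>R v"
    by (intro tendsto_intros z B)
  then have 2: "(\<lambda>n. Hw (p + c n *\<^sub>R w + d n *\<^sub>R v) v) \<longlonglongrightarrow> Hw p v"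
    using isCont_tendsto_compose[OF cw] by simp
  show ?thesis using LIMSEQ_unique[OF 1] 2 E by simp
qed

section \<open>Derivatives of smooth maps\<close>

lemma smooth_has_derivative:
  assumes "smooth f"
  shows "(f has_derivative frechet_derivative f (at p)) (at p)"
proof -
  have "times_cont_diff 1 f" using assms by (simp add: smooth_def)
  then show ?thesis
    by (simp add: differentiable_on_def frechet_derivative_works[symmetric])
qed

lemma smooth_dir_deriv_const:
  assumes "smooth f"
  shows "smooth (\<lambda>p. frechet_derivative f (at p) v)"
  using assms unfolding smooth_def by (metis times_cont_diff.simps(2))

lemma smooth_continuous: "smooth f \<Longrightarrow> continuous_on UNIV f"
  by (metis smooth_def times_cont_diff.simps(1))

lemma smooth_const: "smooth (\<lambda>_. c)"
proof -
  have "times_cont_diff k (\<lambda>_. c)" for k and c :: 'b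
    by (induction k arbitrary: c) auto
  then show ?thesis unfolding smooth_def by blast
qed

text \<open>Reduces to the real-valued case by taking components in the target space.\<close>
lemma smooth_second_derivative_symmetric:
  fixes f :: "'a::real_normed_vector \<Rightarrow> 'b::euclidean_space"
  assumes f: "smooth f"
  shows "frechet_derivative (\<lambda>q. frechet_derivative f (at q) v) (at p) w
       = frechet_derivative (\<lambda>q. frechet_derivative f (at q) w) (at p) v"
proof (rule euclidean_eqI)
  fix e :: 'b
  note d = smooth_has_derivative[OF f] smooth_has_derivative[OF smooth_dir_deriv_const[OF f]]
  have c: "isCont (\<lambda>q. frechet_derivative (\<lambda>q. frechet_derivative f (at q) v) (at q) w) p" for v w
    using smooth_continuous[OF smooth_dir_deriv_const[OF smooth_dir_deriv_const[OF f]]]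
    by (simp add: continuous_on_eq_continuous_at)
  show "frechet_derivative (\<lambda>q. frechet_derivative f (at q) v) (at p) w \<bullet> e
      = frechet_derivative (\<lambda>q. frechet_derivative f (at q) w) (at p) v \<bullet> e"
    by (rule second_derivative_symmetric_real[where g = "\<lambda>q. f q \<bullet> e"
          and G = "\<lambda>q h. frechet_derivative f (at q) h \<bullet> e"])
       (intro has_derivative_inner_left d continuous_intros c)+
qed

text \<open>Smoothness only gives control of the derivative along fixed vectors.  Expanding the
  field \<open>Y\<close> in a basis reduces the derivative of \<open>q \<mapsto> DZ(q)(Y q)\<close> to the product rule for finitely
  many fixed directions.\<close>
lemma has_derivative_dir_deriv:
  fixes Y :: "'a::euclidean_space \<Rightarrow> 'a" and Z :: "'a \<Rightarrow> 'b::real_normed_vector"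
  assumes Y: "smooth Y" and Z: "smooth Z"
  shows "(dir_deriv Y Z has_derivative
     (\<lambda>h. frechet_derivative (\<lambda>q. frechet_derivative Z (at q) (Y p)) (at p) h
        + frechet_derivative Z (at p) (frechet_derivative Y (at p) h))) (at p)"
proof -
  let ?D = "\<lambda>q. frechet_derivative Z (at q)"
  have ex: "?D q v = (\<Sum>b\<in>Basis. (v \<bullet> b) *\<^sub>R ?D q b)" for q v
  proof -
    have l: "linear (?D q)" by (rule has_derivative_linear[OF smooth_has_derivative[OF Z]])
    have "?D q v = ?D q (\<Sum>b\<in>Basis. (v \<bullet> b) *\<^sub>R b)" by (simp add: euclidean_representation)
    also have "\<dots> = (\<Sum>b\<in>Basis. (v \<bullet> b) *\<^sub>R ?D q b)"
      by (simp add: linear_sum[OF l] linear_cmul[OF l])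
    finally show ?thesis .
  qed
  note dD = smooth_has_derivative[OF smooth_dir_deriv_const[OF Z]]
  have c: "((\<lambda>q. ?D q v) has_derivative
      (\<lambda>h. \<Sum>b\<in>Basis. (v \<bullet> b) *\<^sub>R frechet_derivative (\<lambda>q. ?D q b) (at p) h)) (at p)" for v
    by (subst ex) (intro has_derivative_sum has_derivative_scaleR_right dD)
  have c': "frechet_derivative (\<lambda>q. ?D q v) (at p) =
      (\<lambda>h. \<Sum>b\<in>Basis. (v \<bullet> b) *\<^sub>R frechet_derivative (\<lambda>q. ?D q b) (at p) h)" for v
    using frechet_derivative_at[OF c] by simp
  have "((\<lambda>q. \<Sum>b\<in>Basis. (Y q \<bullet> b) *\<^sub>R ?D q b) has_derivative
     (\<lambda>h. \<Sum>b\<in>Basis. (Y p \<bullet> b) *\<^sub>R frechet_derivative (\<lambda>q. ?D q b) (at p) h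
         + (frechet_derivative Y (at p) h \<bullet> b) *\<^sub>R ?D p b)) (at p)"
    by (intro has_derivative_sum has_derivative_scaleR has_derivative_inner_left
        smooth_has_derivative[OF Y] dD)
  moreover have "dir_deriv Y Z = (\<lambda>q. \<Sum>b\<in>Basis. (Y q \<bullet> b) *\<^sub>R ?D q b)"
    unfolding dir_deriv_def by (subst ex) (rule refl)
  ultimately show ?thesis
    unfolding c'[of "Y p"] ex[of p "frechet_derivative Y (at p) _"] by (simp add: sum.distrib)
qed

section \<open>Torsion, duality and curvature of a constant shift of the flat connection\<close>

text \<open>In \<open>\<nabla>\<^sub>X\<nabla>\<^sub>Y Z - \<nabla>\<^sub>Y\<nabla>\<^sub>X Z\<close> the second derivatives of \<open>Z\<close> cancel by symmetry, the terms
  \<open>K(X, DZ Y) + K(Y, DZ X)\<close> occur in both summands, and the terms in the derivatives of \<open>X\<close> and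
  \<open>Y\<close> are those of \<open>\<nabla>\<close> along the Lie bracket.\<close>
lemma curvature_add_tensor:
  fixes K :: "'a::euclidean_space \<Rightarrow> 'a \<Rightarrow> 'a"
  assumes K: "bounded_bilinear K" and X: "smooth X" and Y: "smooth Y" and Z: "smooth Z"
  shows "curvature (add_tensor euclidean_connection K) X Y Z p
       = commutator (K (X p)) (K (Y p)) (Z p)"
proof -
  interpret K: bounded_bilinear K by (rule K)
  let ?N = "add_tensor euclidean_connection K"
  have inner: "frechet_derivative (?N Y Z) (at p) = (\<lambda>h.
       frechet_derivative (\<lambda>q. frechet_derivative Z (at q) (Y p)) (at p) h
        + frechet_derivative Z (at p) (frechet_derivative Y (at p) h)
        + (K (Y p) (frechet_derivative Z (at p) h) + K (frechet_derivative Y (at p) h) (Z p)))"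
    if Y: "smooth Y" for Y
    unfolding add_tensor_def euclidean_connection_def
    by (rule frechet_derivative_at[symmetric])
       (rule has_derivative_add[OF has_derivative_dir_deriv[OF Y Z]
          K.FDERIV[OF smooth_has_derivative[OF Y] smooth_has_derivative[OF Z]]])
  have lin: "linear (frechet_derivative Z (at p))"
    by (rule has_derivative_linear[OF smooth_has_derivative[OF Z]])
  have out: "?N X W p = frechet_derivative W (at p) (X p) + K (X p) (W p)" for X W
    by (simp add: add_tensor_def euclidean_connection_def dir_deriv_def)
  have "curvature ?N X Y Z p = ?N X (?N Y Z) p - ?N Y (?N X Z) p - ?N (lie_bracket X Y) Z p"
    by (simp only: curvature_def)
  also have "\<dots> = K (X p) (K (Y p) (Z p)) - K (Y p) (K (X p) (Z p))"
    unfolding out inner[OF X] inner[OF Y] lie_bracket_def dir_deriv_def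
      linear_diff[OF lin] K.add_right K.diff_left
      smooth_second_derivative_symmetric[OF Z, of "X p" p "Y p"]
    by (simp only: algebra_simps)
  finally show ?thesis by (simp only: commutator_def)
qed

lemma torsion_free_add_tensor:
  assumes "\<And>x y. K x y = K y x"
  shows "torsion_free (add_tensor euclidean_connection K)"
  by (simp add: torsion_free_def torsion_def add_tensor_def euclidean_connection_def
      lie_bracket_def assms)

text \<open>Constant fields are smooth, so vanishing curvature can be tested on them.\<close>
lemma flat_add_tensor_iff:
  fixes K :: "'a::euclidean_space \<Rightarrow> 'a \<Rightarrow> 'a"
  assumes K: "bounded_bilinear K" and sym: "\<And>x y. K x y = K y x"
  shows "flat (add_tensor euclidean_connection K)
     \<longleftrightarrow> (\<forall>X Y. commutator (K X) (K Y) = (\<lambda>_. 0))"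
proof
  assume "flat (add_tensor euclidean_connection K)"
  then have f: "curvature (add_tensor euclidean_connection K) X Y Z p = 0"
    if "smooth X" "smooth Y" "smooth Z" for X Y Z p
    using that unfolding flat_def curvature_free_def by iprover
  show "\<forall>X Y. commutator (K X) (K Y) = (\<lambda>_. 0)"
  proof (intro allI ext)
    fix X Y v :: 'a
    have "curvature (add_tensor euclidean_connection K) (\<lambda>_. X) (\<lambda>_. Y) (\<lambda>_. v) 0 = 0"
      by (rule f[OF smooth_const smooth_const smooth_const])
    then show "commutator (K X) (K Y) v = 0"
      by (simp add: curvature_add_tensor[OF K smooth_const smooth_const smooth_const])
  qed
next
  assume c: "\<forall>X Y. commutator (K X) (K Y) = (\<lambda>_. 0)"
  have "curvature_free (add_tensor euclidean_connection K)"
    unfolding curvature_free_def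
  proof (intro allI impI)
    fix X Y Z :: "'a \<Rightarrow> 'a" and p
    assume XYZ: "smooth X" "smooth Y" "smooth Z"
    show "curvature (add_tensor euclidean_connection K) X Y Z p = 0"
      unfolding curvature_add_tensor[OF K XYZ] using c by simp
  qed
  moreover have "torsion_free (add_tensor euclidean_connection K)"
    by (rule torsion_free_add_tensor[OF sym])
  ultimately show "flat (add_tensor euclidean_connection K)"
    unfolding flat_def by (rule conjI)
qed

lemma metric_dual_add_tensor:
  assumes adj: "\<And>x y z. L x z \<bullet> y = - (K x y \<bullet> z)"
  shows "metric_dual (add_tensor euclidean_connection K) (add_tensor euclidean_connection L)"
  unfolding metric_dual_def
proof (intro allI impI)
  fix X Y Z :: "'a \<Rightarrow> 'a" and p
  assume YZ: "smooth Y" "smooth Z"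
  have "frechet_derivative (\<lambda>q. Y q \<bullet> Z q) (at p) = (\<lambda>h. Y p \<bullet> frechet_derivative Z (at p) h
      + frechet_derivative Y (at p) h \<bullet> Z p)"
    by (rule frechet_derivative_at[symmetric])
       (intro has_derivative_inner smooth_has_derivative YZ)
  then show "dir_deriv X (\<lambda>q. Y q \<bullet> Z q) p = add_tensor euclidean_connection K X Y p \<bullet> Z p
      + Y p \<bullet> add_tensor euclidean_connection L X Z p"
    using adj[of "X p" "Z p" "Y p"]
    by (simp add: add_tensor_def euclidean_connection_def dir_deriv_def inner_add_left
        inner_add_right inner_commute)
qed

lemma represents_bounded_bilinear:
  fixes C :: "'a::euclidean_space \<Rightarrow> 'a \<Rightarrow> 'a \<Rightarrow> real"
  assumes "represents K C" "trilinear C"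
  shows "bounded_bilinear K"
proof -
  have i: "K x y \<bullet> z = C x y z" for x y z using assms by (simp add: represents_def)
  have lin: "linear (\<lambda>x. C x y z)" "linear (\<lambda>y. C x y z)" for x y z
    using assms(2) by (simp_all add: trilinear_def)
  have "linear (\<lambda>y. K x y)" for x
    by (rule linearI; subst vector_eq_rdot[symmetric])
       (simp_all add: i inner_add_left linear_add[OF lin(2)] linear_cmul[OF lin(2)])
  moreover have "linear (\<lambda>x. K x y)" for y
    by (rule linearI; subst vector_eq_rdot[symmetric])
       (simp_all add: i inner_add_left linear_add[OF lin(1)] linear_cmul[OF lin(1)])
  ultimately have "bilinear K" by (simp add: bilinear_def)
  then show ?thesis by (simp add: bilinear_conv_bounded_bilinear)
qed

lemma represents_symmetric:
  assumes "represents K C" "totally_symmetric C"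
  shows "K x y = K y x"
proof (subst vector_eq_rdot[symmetric], intro allI)
  show "K x y \<bullet> z = K y x \<bullet> z" for z
    using assms by (simp add: represents_def totally_symmetric_def)
qed

text \<open>The witness is the polarization of the cubic form \<open>3x\<^sub>i\<^sup>2x\<^sub>j\<close> for two distinct coordinates.  There
  \<open>K(e\<^sub>i, e\<^sub>i) = e\<^sub>j\<close>, \<open>K(e\<^sub>i, e\<^sub>j) = e\<^sub>i\<close> and \<open>K(e\<^sub>j, e\<^sub>j) = 0\<close>, so the commutator of
  \<open>K\<close> at \<open>e\<^sub>i\<close> and \<open>e\<^sub>j\<close> takes \<open>e\<^sub>i\<close> to \<open>e\<^sub>j\<close>.\<close>
lemma exists_nonflat:
  assumes "CARD('n) \<ge> 2"
  shows "\<exists>(C :: (real ^ 'n) \<Rightarrow> (real ^ 'n) \<Rightarrow> (real ^ 'n) \<Rightarrow> real) K.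
           nonzero_cubic_form C \<and> represents K C \<and> \<not> flat (add_tensor euclidean_connection K)"
proof -
  obtain i j :: 'n where ij: "i \<noteq> j"
    using assms by (metis card_2_iff' ex_card)
  define C :: "(real ^ 'n) \<Rightarrow> (real ^ 'n) \<Rightarrow> (real ^ 'n) \<Rightarrow> real"
    where "C X Y Z = X $ i * Y $ i * Z $ j + X $ i * Y $ j * Z $ i + X $ j * Y $ i * Z $ i" for X Y Z
  define K :: "(real ^ 'n) \<Rightarrow> (real ^ 'n) \<Rightarrow> (real ^ 'n)"
    where "K X Y = (X $ i * Y $ j + X $ j * Y $ i) *\<^sub>R axis i 1 + (X $ i * Y $ i) *\<^sub>R axis j 1" for X Y
  have rep: "represents K C"
    by (simp add: represents_def K_def C_def inner_add_left inner_axis' algebra_simps)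
  have tri: "trilinear C"
    unfolding trilinear_def by (auto intro!: linearI simp: C_def algebra_simps)
  have sym: "totally_symmetric C"
    by (auto simp: totally_symmetric_def C_def)
  have "C (axis i 1) (axis i 1) (axis j 1) = 1" using ij by (simp add: C_def axis_def)
  then have nz: "nonzero_cubic_form C"
    unfolding nonzero_cubic_form_def using tri sym by (metis zero_neq_one)
  have "commutator (K (axis i 1)) (K (axis j 1)) (axis i 1) = axis j 1"
    using ij by (simp add: commutator_def K_def axis_def vec_eq_iff)
  moreover have "axis j 1 \<noteq> (0 :: real ^ 'n)" by (simp add: axis_eq_0_iff)
  ultimately have "commutator (K (axis i 1)) (K (axis j 1)) \<noteq> (\<lambda>_. 0)" by auto
  then have "\<not> flat (add_tensor euclidean_connection K)"
    using flat_add_tensor_iff[OF represents_bounded_bilinear[OF rep tri] represents_symmetric[OF rep sym]]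
    by auto
  with nz rep show ?thesis by blast
qed

section \<open>Bounds and uniqueness for short geodesics\<close>

lemma christoffel_add_tensor:
  "christoffel (add_tensor euclidean_connection K) p u v = K u v"
  by (simp add: christoffel_def add_tensor_def euclidean_connection_def dir_deriv_def)

lemma geodesic_add_tensor_iff:
  "geodesic (add_tensor euclidean_connection K) \<gamma> \<longleftrightarrow> \<gamma> \<in> extensional {0..1} \<and>
     (\<exists>u. \<forall>t\<in>{0..1}. (\<gamma> has_vector_derivative u t) (at t within {0..1}) \<and>
        (u has_vector_derivative - K (u t) (u t)) (at t within {0..1}))"
proof -
  have *: "(a has_vector_derivative b) F \<and> b + c = 0 \<longleftrightarrow>
    (a has_vector_derivative - c) F \<and> b = - c" for a :: "real \<Rightarrow> 'a" and b c F
    by (auto simp: add_eq_0_iff2)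
  have "(\<exists>u w. \<forall>t\<in>{0..1}. (\<gamma> has_vector_derivative u t) (at t within {0..1}) \<and>
      (u has_vector_derivative w t) (at t within {0..1}) \<and> w t + K (u t) (u t) = 0) \<longleftrightarrow>
    (\<exists>u. \<forall>t\<in>{0..1}. (\<gamma> has_vector_derivative u t) (at t within {0..1}) \<and>
        (u has_vector_derivative - K (u t) (u t)) (at t within {0..1}))" (is "?L \<longleftrightarrow> ?R")
  proof
    show "?L \<Longrightarrow> ?R" unfolding * by blast
    assume ?R
    then obtain u where "\<forall>t\<in>{0..1}. (\<gamma> has_vector_derivative u t) (at t within {0..1}) \<and>
        (u has_vector_derivative - K (u t) (u t)) (at t within {0..1})" by blast
    then show ?L unfolding * by (intro exI[of _ u] exI[of _ "\<lambda>t. - K (u t) (u t)"]) simp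
  qed
  then show ?thesis
    unfolding geodesic_def christoffel_add_tensor by (rule arg_cong)
qed

lemma vector_derivative_lipschitz:
  fixes f :: "real \<Rightarrow> 'a::real_normed_vector"
  assumes "convex S" "\<And>t. t \<in> S \<Longrightarrow> (f has_vector_derivative f' t) (at t within S)"
    and "\<And>t. t \<in> S \<Longrightarrow> norm (f' t) \<le> B" and "a \<in> S" "b \<in> S"
  shows "norm (f b - f a) \<le> B * \<bar>b - a\<bar>"
proof -
  have "norm (f b - f a) \<le> B * norm (b - a)"
  proof (rule differentiable_bound[where f' = "\<lambda>t h. h *\<^sub>R f' t"])
    show "(f has_derivative (\<lambda>h. h *\<^sub>R f' t)) (at t within S)" if "t \<in> S" for t
      using assms(2)[OF that] by (simp add: has_vector_derivative_def)
    show "onorm (\<lambda>h. h *\<^sub>R f' t) \<le> B" if "t \<in> S" for t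
    proof (rule onorm_le)
      show "norm (h *\<^sub>R f' t) \<le> B * norm h" for h
        using mult_left_mono[OF assms(3)[OF that], of "\<bar>h\<bar>"] by (simp add: mult.commute)
    qed
  qed (use assms in auto)
  then show ?thesis by simp
qed

text \<open>The velocity has mean zero and varies by at most \<open>B\<close> over a unit of time, so it never
  exceeds \<open>B\<close>.\<close>
lemma velocity_le_acceleration:
  fixes f :: "real \<Rightarrow> 'a::real_normed_vector"
  assumes f: "\<And>t. t \<in> {0..1} \<Longrightarrow> (f has_vector_derivative u t) (at t within {0..1})"
    and u: "\<And>t. t \<in> {0..1} \<Longrightarrow> (u has_vector_derivative a t) (at t within {0..1})"
    and B: "\<And>t. t \<in> {0..1} \<Longrightarrow> norm (a t) \<le> B"
    and ends: "f 0 = f 1" and t: "t \<in> {0..1}"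
  shows "norm (u t) \<le> B"
proof -
  have B0: "0 \<le> B" using B[OF t] norm_ge_zero order_trans by blast
  have "norm (u s - u t) \<le> B" if "s \<in> {0..1}" for s
  proof -
    have "norm (u s - u t) \<le> B * \<bar>s - t\<bar>"
      by (rule vector_derivative_lipschitz[OF _ u B]) (use t that in auto)
    also have "\<dots> \<le> B * 1" using t that by (intro mult_left_mono B0) auto
    finally show ?thesis by simp
  qed
  then have "norm (f 1 - f 0 - (1 - 0) *\<^sub>R u t) \<le> norm (1 - 0 :: real) * B"
    by (intro vector_differentiable_bound_linearization[OF f]) (use t in \<open>auto simp: closed_segment_eq_real_ivl\<close>)
  then show ?thesis using ends by simp
qed

text \<open>Let \<open>V\<close> be the maximal speed.  Over a time \<open>h \<le> 1/2\<close>, run forwards or backwards from the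
  instant of maximal speed, the curve covers \<open>hV\<close> up to an error \<open>k(hV)\<^sup>2\<close>, while it can move by
  at most the diameter \<open>2\<delta>\<close>.  So \<open>x - kx\<^sup>2 \<le> 2\<delta>\<close> for every \<open>x\<close> in \<open>[0, V/2]\<close>.  For \<open>k > 0\<close> the
  left-hand side has maximum \<open>1/(4k) > 2\<delta>\<close>, attained at \<open>x = 1/(2k)\<close>; hence \<open>V/2\<close> lies below this value,
  where \<open>x/2 \<le> x - kx\<^sup>2\<close>.\<close>
lemma velocity_bound_of_confined:
  fixes f :: "real \<Rightarrow> 'a::real_normed_vector"
  assumes f: "\<And>t. t \<in> {0..1} \<Longrightarrow> (f has_vector_derivative u t) (at t within {0..1})"
    and u: "\<And>t. t \<in> {0..1} \<Longrightarrow> (u has_vector_derivative a t) (at t within {0..1})"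
    and a: "\<And>t. t \<in> {0..1} \<Longrightarrow> norm (a t) \<le> k * (norm (u t))\<^sup>2"
    and k: "0 \<le> k" and small: "8 * k * \<delta> < 1"
    and conf: "\<And>t. t \<in> {0..1} \<Longrightarrow> dist x (f t) \<le> \<delta>" and t: "t \<in> {0..1}"
  shows "norm (u t) \<le> 8 * \<delta>"
proof -
  have "continuous_on {0..1} u"
    using u has_vector_derivative_continuous continuous_on_eq_continuous_within by blast
  then have "continuous_on {0..1} (\<lambda>t. norm (u t))" by (intro continuous_intros)
  then obtain m where m: "m \<in> {0..1}" and max: "\<And>s. s \<in> {0..1} \<Longrightarrow> norm (u s) \<le> norm (u m)"
    using continuous_attains_sup[of "{0..1::real}" "\<lambda>t. norm (u t)"] by auto
  define V where "V = norm (u m)"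
  have V0: "0 \<le> V" by (simp add: V_def)
  have aV: "norm (a s) \<le> k * V\<^sup>2" if "s \<in> {0..1}" for s
  proof -
    have "norm (a s) \<le> k * (norm (u s))\<^sup>2" by (rule a[OF that])
    also have "\<dots> \<le> k * V\<^sup>2" unfolding V_def
      by (intro mult_left_mono power_mono max that k) auto
    finally show ?thesis .
  qed
  have step: "h * V \<le> 2 * \<delta> + k * (h * V)\<^sup>2" if h: "0 \<le> h" "h \<le> 1/2" for h
  proof -
    define r where "r = (if m \<le> 1/2 then m + h else m - h)"
    have r: "r \<in> {0..1}" "\<bar>r - m\<bar> = h" using m h by (auto simp: r_def)
    let ?S = "closed_segment m r"
    have S: "?S \<subseteq> {0..1}" using m r(1) by (simp add: closed_segment_subset)
    have SS: "s \<in> {0..1}" "\<bar>s - m\<bar> \<le> h" if "s \<in> ?S" for s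
      using S that r(2) by (auto simp: closed_segment_eq_real_ivl split: if_splits)
    have fS: "(f has_vector_derivative u s) (at s within ?S)"
      and uS: "(u has_vector_derivative a s) (at s within ?S)" if "s \<in> ?S" for s
      using f[OF SS(1)[OF that]] u[OF SS(1)[OF that]] S
      by (auto intro: has_vector_derivative_within_subset)
    have "norm (u s - u m) \<le> k * V\<^sup>2 * h" if "s \<in> ?S" for s
    proof -
      have "norm (u s - u m) \<le> k * V\<^sup>2 * \<bar>s - m\<bar>"
        by (rule vector_derivative_lipschitz[OF _ uS aV]) (use that SS in auto)
      also have "\<dots> \<le> k * V\<^sup>2 * h" using SS[OF that] k by (intro mult_left_mono) auto
      finally show ?thesis .
    qed
    then have "norm (f r - f m - (r - m) *\<^sub>R u m) \<le> norm (r - m) * (k * V\<^sup>2 * h)"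
      by (intro vector_differentiable_bound_linearization[OF fS]) auto
    then have 1: "norm ((f r - f m) - (r - m) *\<^sub>R u m) \<le> k * (h * V)\<^sup>2"
      using r(2) by (simp add: power2_eq_square algebra_simps)
    have 2: "norm (f r - f m) \<le> 2 * \<delta>"
      using conf[OF r(1)] conf[OF m] dist_triangle3[of "f r" "f m" x] by (simp add: dist_norm)
    have "norm ((r - m) *\<^sub>R u m) \<le> norm (f r - f m) + norm ((f r - f m) - (r - m) *\<^sub>R u m)"
      using norm_triangle_ineq4[of "f r - f m" "(f r - f m) - (r - m) *\<^sub>R u m"] by simp
    moreover have "norm ((r - m) *\<^sub>R u m) = h * V" using r(2) by (simp add: V_def)
    ultimately show ?thesis using 1 2 by linarith
  qed
  have kV: "k * V < 1"
  proof (rule ccontr)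
    assume "\<not> k * V < 1"
    then have c: "1 \<le> k * V" by simp
    have "k \<noteq> 0" "V \<noteq> 0" using c by auto
    with k V0 have pos: "0 < k" "0 < V" by auto
    have "1 / (2 * k * V) \<le> 1 / 2" using c by (simp add: field_simps)
    then have "1 / (2 * k) \<le> 2 * \<delta> + k * (1 / (2 * k))\<^sup>2"
      using step[of "1 / (2 * k * V)"] pos by simp
    then have "1 \<le> 8 * k * \<delta>" using pos by (simp add: field_simps power2_eq_square)
    with small show False by simp
  qed
  have "k * (1 / 2 * V)\<^sup>2 = (k * V) * V / 4" by (simp add: power2_eq_square)
  also have "\<dots> \<le> V / 4" using mult_right_mono[OF less_imp_le[OF kV] V0] by simp
  finally have "V \<le> 8 * \<delta>" using step[of "1/2"] by simp
  then show ?thesis using max[OF t] by (simp add: V_def)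
qed

lemma confined_geodesic_velocity:
  fixes K :: "'a::real_inner \<Rightarrow> 'a \<Rightarrow> 'a"
  assumes bound: "\<And>x y. norm (K x y) \<le> k * norm x * norm y" and k: "0 \<le> k"
    and small: "8 * k * norm (P - Q) < 1"
    and g: "confined_geodesic (add_tensor euclidean_connection K) P Q \<gamma>"
  shows "\<exists>u. \<forall>t\<in>{0..1}.
    (\<gamma> has_vector_derivative u t) (at t within {0..1}) \<and>
    (u has_vector_derivative - K (u t) (u t)) (at t within {0..1}) \<and> norm (u t) \<le> 8 * norm (P - Q)"
proof -
  obtain u where u:
    "\<And>t. t \<in> {0..1} \<Longrightarrow> (\<gamma> has_vector_derivative u t) (at t within {0..1})"
    "\<And>t. t \<in> {0..1} \<Longrightarrow> (u has_vector_derivative - K (u t) (u t)) (at t within {0..1})"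
    using g unfolding confined_geodesic_def geodesic_add_tensor_iff by blast
  have acc: "norm (- K (u t) (u t)) \<le> k * (norm (u t))\<^sup>2" for t
    using bound[of "u t" "u t"] by (simp add: power2_eq_square mult.assoc)
  have conf: "dist (midpoint P Q) (\<gamma> t) \<le> norm (P - Q)" if "t \<in> {0..1}" for t
  proof -
    have "\<gamma> t \<in> ball (midpoint P Q) (norm (P - Q))"
      using g that unfolding confined_geodesic_def by blast
    then show ?thesis by simp
  qed
  have "norm (u t) \<le> 8 * norm (P - Q)" if "t \<in> {0..1}" for t
    by (rule velocity_bound_of_confined[OF u acc k small conf that])
  with u show ?thesis by blast
qed

text \<open>From \<open>K(x, x) - K(y, y) = K(x - y, x) + K(y, x - y)\<close>.\<close>
lemma bilinear_diff_bound:
  assumes K: "bounded_bilinear K" and bound: "\<And>x y. norm (K x y) \<le> k * norm x * norm y"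
    and k: "0 \<le> k" and x: "norm x \<le> b" and y: "norm y \<le> b"
  shows "norm (K x x - K y y) \<le> 2 * k * b * norm (x - y)"
proof -
  interpret bounded_bilinear K by (rule K)
  have "K x x - K y y = K (x - y) x + K y (x - y)" by (simp add: diff_left diff_right)
  then have "norm (K x x - K y y) \<le> norm (K (x - y) x) + norm (K y (x - y))"
    by (simp add: norm_triangle_ineq)
  also have "\<dots> \<le> k * norm (x - y) * norm x + k * norm y * norm (x - y)"
    by (intro add_mono bound)
  also have "\<dots> \<le> k * norm (x - y) * b + k * b * norm (x - y)"
    by (intro add_mono mult_left_mono mult_right_mono x y) (auto simp: k)
  finally show ?thesis by (simp add: algebra_simps)
qed

text \<open>Both velocities are at most \<open>8\<delta>\<close>, so the accelerations differ by at most \<open>16k\<delta>\<close> times the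
  maximal difference \<open>W\<close> of the velocities.  As the end points agree, \<open>W \<le> 16k\<delta>W\<close>, whence
  \<open>W = 0\<close>.\<close>
lemma confined_geodesic_unique:
  fixes K :: "'a::real_inner \<Rightarrow> 'a \<Rightarrow> 'a"
  assumes K: "bounded_bilinear K" and bound: "\<And>x y. norm (K x y) \<le> k * norm x * norm y"
    and k: "0 \<le> k" and small: "16 * k * norm (P - Q) < 1"
    and g1: "confined_geodesic (add_tensor euclidean_connection K) P Q \<gamma>"
    and g2: "confined_geodesic (add_tensor euclidean_connection K) P Q \<beta>"
  shows "\<gamma> = \<beta>"
proof -
  let ?d = "norm (P - Q)"
  have small': "8 * k * ?d < 1" using small mult_nonneg_nonneg[OF k norm_ge_zero[of "P - Q"]] by simp
  obtain u where u: "\<And>t. t \<in> {0..1} \<Longrightarrow> (\<gamma> has_vector_derivative u t) (at t within {0..1})"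
    "\<And>t. t \<in> {0..1} \<Longrightarrow> (u has_vector_derivative - K (u t) (u t)) (at t within {0..1})"
    "\<And>t. t \<in> {0..1} \<Longrightarrow> norm (u t) \<le> 8 * ?d"
    using confined_geodesic_velocity[OF bound k small' g1] by blast
  obtain v where v: "\<And>t. t \<in> {0..1} \<Longrightarrow> (\<beta> has_vector_derivative v t) (at t within {0..1})"
    "\<And>t. t \<in> {0..1} \<Longrightarrow> (v has_vector_derivative - K (v t) (v t)) (at t within {0..1})"
    "\<And>t. t \<in> {0..1} \<Longrightarrow> norm (v t) \<le> 8 * ?d"
    using confined_geodesic_velocity[OF bound k small' g2] by blast
  let ?w = "\<lambda>t. u t - v t"
  have f: "((\<lambda>t. \<gamma> t - \<beta> t) has_vector_derivative ?w t) (at t within {0..1})"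
    and w: "(?w has_vector_derivative - K (u t) (u t) - - K (v t) (v t)) (at t within {0..1})"
    if "t \<in> {0..1}" for t
    using has_vector_derivative_diff[OF u(1)[OF that] v(1)[OF that]]
      has_vector_derivative_diff[OF u(2)[OF that] v(2)[OF that]] by blast+
  have "continuous_on {0..1} ?w"
    using w has_vector_derivative_continuous continuous_on_eq_continuous_within by blast
  then have "continuous_on {0..1} (\<lambda>t. norm (?w t))" by (rule continuous_on_norm)
  then obtain m where m: "m \<in> {0..1}" and max: "\<And>s. s \<in> {0..1} \<Longrightarrow> norm (?w s) \<le> norm (?w m)"
    using continuous_attains_sup[of "{0..1::real}" "\<lambda>t. norm (?w t)"] by auto
  have "norm (?w m) \<le> 16 * k * ?d * norm (?w m)"
  proof (rule velocity_le_acceleration[OF f w _ _ m])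
    fix t :: real assume t: "t \<in> {0..1}"
    have "norm (- K (u t) (u t) - - K (v t) (v t)) = norm (K (u t) (u t) - K (v t) (v t))"
      by (simp add: norm_minus_commute)
    also have "\<dots> \<le> 2 * k * (8 * ?d) * norm (?w t)"
      by (rule bilinear_diff_bound[OF K bound k u(3)[OF t] v(3)[OF t]])
    also have "\<dots> \<le> 2 * k * (8 * ?d) * norm (?w m)"
      by (intro mult_left_mono max t) (simp add: k)
    finally show "norm (- K (u t) (u t) - - K (v t) (v t)) \<le> 16 * k * ?d * norm (?w m)" by simp
  qed (use g1 g2 in \<open>auto simp: confined_geodesic_def\<close>)
  then have "(1 - 16 * k * ?d) * norm (?w m) \<le> 0" by (simp add: algebra_simps)
  with small have "norm (?w m) \<le> 0" by (simp add: mult_le_0_iff)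
  then have w0: "norm (?w t) \<le> 0" if "t \<in> {0..1}" for t
    using max[OF that] by linarith
  have "\<gamma> t = \<beta> t" if "t \<in> {0..1}" for t
    using vector_derivative_lipschitz[OF _ f w0, of 0 t] that g1 g2
    by (simp add: confined_geodesic_def)
  moreover have "\<gamma> \<in> extensional {0..1}" "\<beta> \<in> extensional {0..1}"
    using g1 g2 by (auto simp: confined_geodesic_def geodesic_def)
  ultimately show ?thesis by (intro extensionalityI[of \<gamma> "{0..1}" \<beta>]) auto
qed

text \<open>The speed bound \<open>8\<delta>\<close> gives acceleration at most \<open>64k\<delta>\<^sup>2\<close>, so the velocity differs from that of the
  chord by at most as much, and half a unit of time separates the midpoint from the end points.\<close>
lemma confined_geodesic_midpoint_estimate:
  fixes K :: "'a::real_inner \<Rightarrow> 'a \<Rightarrow> 'a"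
  assumes bound: "\<And>x y. norm (K x y) \<le> k * norm x * norm y" and k: "0 \<le> k"
    and small: "8 * k * norm (P - Q) < 1"
    and g: "confined_geodesic (add_tensor euclidean_connection K) P Q \<gamma>"
  shows "norm (\<gamma> (1/2) - midpoint P Q) \<le> 32 * k * (norm (P - Q))\<^sup>2"
proof -
  let ?d = "norm (P - Q)"
  obtain u where u: "\<And>t. t \<in> {0..1} \<Longrightarrow> (\<gamma> has_vector_derivative u t) (at t within {0..1})"
    "\<And>t. t \<in> {0..1} \<Longrightarrow> (u has_vector_derivative - K (u t) (u t)) (at t within {0..1})"
    "\<And>t. t \<in> {0..1} \<Longrightarrow> norm (u t) \<le> 8 * ?d"
    using confined_geodesic_velocity[OF bound k small g] by blast
  let ?f = "\<lambda>t. \<gamma> t - (P + t *\<^sub>R (Q - P))"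
  have f: "(?f has_vector_derivative u t - (Q - P)) (at t within {0..1})" if "t \<in> {0..1}" for t
    using u(1)[OF that] by (auto intro!: derivative_eq_intros)
  have f': "((\<lambda>t. u t - (Q - P)) has_vector_derivative - K (u t) (u t)) (at t within {0..1})"
    if "t \<in> {0..1}" for t
    using u(2)[OF that] by (auto intro!: derivative_eq_intros)
  have B: "norm (- K (u t) (u t)) \<le> 64 * k * ?d\<^sup>2" if "t \<in> {0..1}" for t
  proof -
    have "norm (- K (u t) (u t)) \<le> k * norm (u t) * norm (u t)" using bound by simp
    also have "\<dots> \<le> k * (8 * ?d) * (8 * ?d)"
      by (intro mult_mono u(3) that) (auto simp: k)
    finally show ?thesis by (simp add: power2_eq_square)
  qed
  have "norm (u t - (Q - P)) \<le> 64 * k * ?d\<^sup>2" if "t \<in> {0..1}" for t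
    by (rule velocity_le_acceleration[OF f f' B _ that]) (use g in \<open>auto simp: confined_geodesic_def\<close>)
  then have "norm (?f (1/2) - ?f 0) \<le> 64 * k * ?d\<^sup>2 * \<bar>1/2 - 0\<bar>"
    by (intro vector_derivative_lipschitz[OF _ f]) auto
  moreover have "?f 0 = 0" using g by (simp add: confined_geodesic_def)
  moreover have "P + (1/2) *\<^sub>R (Q - P) = midpoint P Q"
    by (simp add: midpoint_def algebra_simps) (simp flip: scaleR_add_left)
  ultimately show ?thesis by simp
qed

section \<open>Existence of short geodesics\<close>

text \<open>The solution of \<open>V'' = - f\<close> that vanishes at both ends of the interval: the velocity
  is a primitive of \<open>- f\<close> normalized to have mean zero.\<close>
lemma second_antiderivative_zero_ends:
  fixes f :: "real \<Rightarrow> 'a::banach"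
  assumes f: "continuous_on {0..1} f"
  shows "\<exists>V v. V 0 = 0 \<and> V 1 = 0 \<and> (\<forall>t\<in>{0..1}.
     (V has_vector_derivative v t) (at t within {0..1}) \<and>
     (v has_vector_derivative - f t) (at t within {0..1}))"
proof -
  define F where "F t = integral {0..t} f" for t
  define v where "v t = integral {0..1} F - F t" for t
  define V where "V t = integral {0..t} v" for t
  have F: "(F has_vector_derivative f t) (at t within {0..1})" if "t \<in> {0..1}" for t
    unfolding F_def[abs_def] by (rule integral_has_vector_derivative[OF f that])
  have v: "(v has_vector_derivative - f t) (at t within {0..1})" if "t \<in> {0..1}" for t
    unfolding v_def[abs_def] using F[OF that] by (auto intro!: derivative_eq_intros)
  have cont: "continuous_on {0..1} F" "continuous_on {0..1} v"
    using F v has_vector_derivative_continuous continuous_on_eq_continuous_within by blast+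
  have "V 1 = integral {0..1} (\<lambda>_::real. integral {0..1} F) - integral {0..1} F"
    unfolding V_def v_def[abs_def]
    by (subst Henstock_Kurzweil_Integration.integral_diff)
       (intro refl integrable_continuous_real cont continuous_on_const)+
  then have "V 1 = 0" by simp
  moreover have "V 0 = 0" by (simp add: V_def)
  moreover have "(V has_vector_derivative v t) (at t within {0..1})" if "t \<in> {0..1}" for t
    unfolding V_def[abs_def] by (rule integral_has_vector_derivative[OF cont(2) that])
  ultimately show ?thesis using v by blast
qed

text \<open>Given a candidate velocity \<open>u\<close>, solve \<open>V'' = - K(u, u)\<close> with zero boundary values; the curve
  \<open>P + t(Q - P) + V(t)\<close> then joins \<open>P\<close> to \<open>Q\<close>, and it is a geodesic when its velocity
  \<open>Q - P + V'\<close> is \<open>u\<close> again.  On the ball of radius \<open>2\<delta>\<close> in the supremum norm the map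
  \<open>u \<mapsto> Q - P + V'\<close> is a contraction with constant \<open>4k\<delta> < 1/2\<close>.\<close>
lemma confined_geodesic_exists:
  fixes K :: "'a::euclidean_space \<Rightarrow> 'a \<Rightarrow> 'a"
  assumes K: "bounded_bilinear K" and bound: "\<And>x y. norm (K x y) \<le> k * norm x * norm y"
    and k: "0 \<le> k" and small: "8 * k * norm (P - Q) < 1" and ne: "P \<noteq> Q"
  shows "\<exists>\<gamma>. confined_geodesic (add_tensor euclidean_connection K) P Q \<gamma>"
proof -
  define d where "d = norm (P - Q)"
  have d: "0 < d" "norm (Q - P) = d" using ne by (auto simp: d_def norm_minus_commute)
  have kd: "8 * k * d < 1" using small by (simp add: d_def)
  \<comment> \<open>Bounded continuous functions live on the whole line, so velocities are extended from the
    unit interval by constants, that is, composed with \<open>clamp 0 1\<close>.\<close>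
  define sol where "sol u V v g \<longleftrightarrow> V 0 = 0 \<and> V 1 = 0 \<and> (\<forall>t\<in>{0..1}.
      (V has_vector_derivative v t) (at t within {0..1}) \<and>
      (v has_vector_derivative - K (u t) (u t)) (at t within {0..1})) \<and>
      (\<forall>t. g t = Q - P + v (clamp 0 1 t))"
    for u g :: "real \<Rightarrow>\<^sub>C 'a" and V v :: "real \<Rightarrow> 'a"
  have "\<exists>V v g. sol u V v g" for u
  proof -
    have "continuous_on {0..1} (\<lambda>t. K (u t) (u t))"
      by (intro bounded_bilinear.continuous_on[OF K] continuous_on_apply_bcontfun)
    from second_antiderivative_zero_ends[OF this] obtain V v where V: "V 0 = 0" "V 1 = 0"
      "\<forall>t\<in>{0..1}. (V has_vector_derivative v t) (at t within {0..1}) \<and>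
         (v has_vector_derivative - K (u t) (u t)) (at t within {0..1})" by blast
    then have "continuous_on {0..1} v"
      using has_vector_derivative_continuous continuous_on_eq_continuous_within by blast
    then have "continuous_on (cbox 0 1) (\<lambda>t. Q - P + v t)"
      by (simp add: continuous_intros)
    then obtain g :: "real \<Rightarrow>\<^sub>C 'a" where "\<And>t. g t = Q - P + v (clamp 0 1 t)"
      using continuous_on_cbox_bcontfunE by blast
    with V show ?thesis unfolding sol_def by blast
  qed
  then obtain V v T where sol: "\<And>u. sol u (V u) (v u) (T u)" by metis
  have V: "V u 0 = 0" "V u 1 = 0" for u
    using sol[of u] by (simp_all add: sol_def)
  have V': "(V u has_vector_derivative v u t) (at t within {0..1})"
    and v': "(v u has_vector_derivative - K (u t) (u t)) (at t within {0..1})"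
    if "t \<in> {0..1}" for u t
    using sol[of u] that by (simp_all add: sol_def)
  have T: "T u t = Q - P + v u (clamp 0 1 t)" for u t
    using sol[of u] by (simp add: sol_def)
  have clamp: "clamp 0 1 t \<in> {0..1}" for t :: real
    using clamp_in_interval[of 0 1 t] by simp
  have v_bound: "norm (v u t) \<le> 4 * k * d * d" if u: "norm u \<le> 2 * d" and t: "t \<in> {0..1}" for u t
  proof (rule velocity_le_acceleration[OF V' v' _ _ t])
    fix s :: real
    have us: "norm (u s) \<le> 2 * d" using norm_bounded[of u s] u by simp
    have "norm (- K (u s) (u s)) \<le> k * norm (u s) * norm (u s)" using bound by simp
    also have "\<dots> \<le> k * (2 * d) * (2 * d)"
      by (intro mult_mono us) (use k d in auto)
    finally show "norm (- K (u s) (u s)) \<le> 4 * k * d * d" by simp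
  qed (simp_all add: V)
  have small2: "4 * k * d * d < d / 2"
    using mult_strict_right_mono[OF kd d(1)] by simp
  have "\<exists>!u \<in> cball 0 (2 * d). T u = u"
  proof (rule Banach_fix[where c = "1/2"])
    show "complete (cball (0 :: real \<Rightarrow>\<^sub>C 'a) (2 * d))"
      by (simp add: complete_eq_closed)
    show "cball (0 :: real \<Rightarrow>\<^sub>C 'a) (2 * d) \<noteq> {}" using d by simp
    show "T ` cball 0 (2 * d) \<subseteq> cball 0 (2 * d)"
    proof safe
      fix u :: "real \<Rightarrow>\<^sub>C 'a" assume "u \<in> cball 0 (2 * d)"
      then have u: "norm u \<le> 2 * d" by simp
      have "norm (T u t) \<le> 2 * d" for t
        using norm_triangle_ineq[of "Q - P" "v u (clamp 0 1 t)"] v_bound[OF u clamp[of t]]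
          small2 d unfolding T by linarith
      then have "norm (T u) \<le> 2 * d" by (rule norm_bound)
      then show "T u \<in> cball 0 (2 * d)" by simp
    qed
    fix u w :: "real \<Rightarrow>\<^sub>C 'a" assume "u \<in> cball 0 (2 * d)" "w \<in> cball 0 (2 * d)"
    then have "norm u \<le> 2 * d" "norm w \<le> 2 * d" by simp_all
    then have uw: "norm (u s) \<le> 2 * d" "norm (w s) \<le> 2 * d" for s
      using norm_bounded[of u s] norm_bounded[of w s] by simp_all
    show "dist (T u) (T w) \<le> 1 / 2 * dist u w"
    proof (rule dist_bound)
      fix t
      have D1: "((\<lambda>t. V u t - V w t) has_vector_derivative v u s - v w s) (at s within {0..1})"
        if "s \<in> {0..1}" for s
        by (rule has_vector_derivative_diff[OF V'[OF that] V'[OF that]])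
      have D2: "((\<lambda>t. v u t - v w t) has_vector_derivative - K (u s) (u s) - - K (w s) (w s))
          (at s within {0..1})" if "s \<in> {0..1}" for s
        by (rule has_vector_derivative_diff[OF v'[OF that] v'[OF that]])
      have "norm (v u (clamp 0 1 t) - v w (clamp 0 1 t)) \<le> 1 / 2 * dist u w"
      proof (rule velocity_le_acceleration[OF D1 D2 _ _ clamp])
        fix s :: real
        have "norm (- K (u s) (u s) - - K (w s) (w s)) = norm (K (u s) (u s) - K (w s) (w s))"
          by (simp add: norm_minus_commute)
        also have "\<dots> \<le> 2 * k * (2 * d) * norm (u s - w s)"
          by (rule bilinear_diff_bound[OF K bound k uw])
        also have "\<dots> \<le> 2 * k * (2 * d) * dist u w"
          using dist_bounded[of u s w] k d by (intro mult_left_mono) (auto simp: dist_norm)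
        also have "\<dots> \<le> 1 / 2 * dist u w"
          using kd by (intro mult_right_mono) auto
        finally show "norm (- K (u s) (u s) - - K (w s) (w s)) \<le> 1 / 2 * dist u w" .
      qed (simp_all add: V)
      then show "dist (T u t) (T w t) \<le> 1 / 2 * dist u w"
        by (simp add: T dist_norm)
    qed
  qed auto
  then obtain u where "norm u \<le> 2 * d" and fix_u: "T u = u" by auto
  have u: "u t = Q - P + v u t" if "t \<in> {0..1}" for t
    using T[of u t] that by (simp add: fix_u clamp_cancel_cbox)
  let ?g = "\<lambda>t. P + t *\<^sub>R (Q - P) + V u t"
  define \<gamma> where "\<gamma> = restrict ?g {0..1}"
  have \<gamma>: "\<gamma> t = ?g t" if "t \<in> {0..1}" for t using that by (simp add: \<gamma>_def)
  have "geodesic (add_tensor euclidean_connection K) \<gamma>"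
    unfolding geodesic_add_tensor_iff
  proof (intro conjI exI ballI)
    show "\<gamma> \<in> extensional {0..1}" by (simp add: \<gamma>_def)
    fix t :: real assume t: "t \<in> {0..1}"
    have "(?g has_vector_derivative Q - P + v u t) (at t within {0..1})"
      using V'[OF t, of u] by (auto intro!: derivative_eq_intros)
    then show "(\<gamma> has_vector_derivative Q - P + v u t) (at t within {0..1})"
      by (rule has_vector_derivative_transform[OF t, rotated]) (rule \<gamma>)
    have "((\<lambda>t. Q - P + v u t) has_vector_derivative - K (u t) (u t)) (at t within {0..1})"
      using v'[OF t, of u] by (auto intro!: derivative_eq_intros)
    then show "((\<lambda>t. Q - P + v u t) has_vector_derivative
        - K (Q - P + v u t) (Q - P + v u t)) (at t within {0..1})"
      by (simp add: u[OF t])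
  qed
  moreover have "\<gamma> t \<in> ball (midpoint P Q) (norm (P - Q))" if t: "t \<in> {0..1}" for t
  proof -
    have "norm (V u t - V u 0) \<le> 4 * k * d * d * \<bar>t - 0\<bar>"
      by (rule vector_derivative_lipschitz[OF _ V' v_bound[OF \<open>norm u \<le> 2 * d\<close>]]) (use t in auto)
    also have "\<dots> \<le> 4 * k * d * d * 1"
      using t k d by (intro mult_left_mono) auto
    finally have 1: "norm (V u t) < d / 2" using small2 by (simp add: V)
    have "\<gamma> t - midpoint P Q = (t - 1/2) *\<^sub>R (Q - P) + V u t"
      unfolding \<gamma>[OF t] midpoint_def
      by (simp add: algebra_simps) (simp flip: scaleR_add_left)
    then have "norm (\<gamma> t - midpoint P Q) \<le> \<bar>t - 1/2\<bar> * d + norm (V u t)"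
      using norm_triangle_ineq[of "(t - 1/2) *\<^sub>R (Q - P)" "V u t"] d(2) by simp
    also have "\<bar>t - 1/2\<bar> * d \<le> 1/2 * d"
      using t d(1) by (intro mult_right_mono) (auto simp: abs_if)
    finally show ?thesis using 1 by (simp add: dist_norm norm_minus_commute d_def)
  qed
  ultimately show ?thesis
    using \<gamma>[of 0] \<gamma>[of 1] V unfolding confined_geodesic_def by (intro exI[of _ \<gamma>]) auto
qed

section \<open>Geodesic midpoints\<close>

lemma confined_geodesic_ex1:
  fixes K :: "'a::euclidean_space \<Rightarrow> 'a \<Rightarrow> 'a"
  assumes K: "bounded_bilinear K" and bound: "\<And>x y. norm (K x y) \<le> k * norm x * norm y"
    and k: "0 \<le> k" and small: "16 * k * norm (P - Q) < 1" and ne: "P \<noteq> Q"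
  shows "\<exists>!\<gamma>. confined_geodesic (add_tensor euclidean_connection K) P Q \<gamma>"
proof -
  have "8 * k * norm (P - Q) < 1"
    using small mult_nonneg_nonneg[OF k norm_ge_zero[of "P - Q"]] by simp
  from confined_geodesic_exists[OF K bound k this ne]
    confined_geodesic_unique[OF K bound k small] show ?thesis by blast
qed

lemma geodesic_midpoint_estimate:
  fixes K :: "'a::euclidean_space \<Rightarrow> 'a \<Rightarrow> 'a"
  assumes K: "bounded_bilinear K" and bound: "\<And>x y. norm (K x y) \<le> k * norm x * norm y"
    and k: "0 \<le> k" and small: "16 * k * norm (P - Q) < 1"
  shows "norm (geodesic_midpoint (add_tensor euclidean_connection K) P Q - midpoint P Q)
     \<le> 32 * k * (norm (P - Q))\<^sup>2"
proof (cases "P = Q")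
  case False
  have "8 * k * norm (P - Q) < 1"
    using small mult_nonneg_nonneg[OF k norm_ge_zero[of "P - Q"]] by simp
  from confined_geodesic_midpoint_estimate[OF bound k this
      theI'[OF confined_geodesic_ex1[OF K bound k small False]]] False
  show ?thesis by (simp add: geodesic_midpoint_def)
qed (simp add: geodesic_midpoint_def)

text \<open>Reversing time and reflecting in \<open>(P + Q) / 2\<close> each change the sign of the velocity, and
  only the reflection changes that of the acceleration.  Together they turn
  \<open>\<gamma>'' = - K(\<gamma>', \<gamma>')\<close> into \<open>\<gamma>'' = K(\<gamma>', \<gamma>')\<close>, and they preserve the ball around the
  centre of reflection as well as the two end points in their order.\<close>
lemma confined_geodesic_reflect:
  fixes K :: "'a::real_inner \<Rightarrow> 'a \<Rightarrow> 'a"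
  assumes K: "bounded_bilinear K"
    and g: "confined_geodesic (add_tensor euclidean_connection K) P Q \<gamma>"
  shows "confined_geodesic (add_tensor euclidean_connection (\<lambda>x y. - K x y)) P Q
     (restrict (\<lambda>t. P + Q - \<gamma> (1 - t)) {0..1})"
proof -
  interpret K: bounded_bilinear K by (rule K)
  let ?h = "\<lambda>t. P + Q - \<gamma> (1 - t)"
  let ?r = "restrict ?h {0..1}"
  obtain u where u: "\<And>t. t \<in> {0..1} \<Longrightarrow> (\<gamma> has_vector_derivative u t) (at t within {0..1})"
    "\<And>t. t \<in> {0..1} \<Longrightarrow> (u has_vector_derivative - K (u t) (u t)) (at t within {0..1})"
    using g unfolding confined_geodesic_def geodesic_add_tensor_iff by blast
  have rev: "((\<lambda>t. f (1 - t)) has_vector_derivative - f') (at t within {0..1})"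
    if "(f has_vector_derivative f') (at (1 - t) within {0..1})"
    for f :: "real \<Rightarrow> 'a" and f' t
  proof -
    have "(\<lambda>t. 1 - t) ` {0..1} = {0..1 :: real}"
      by (auto simp: image_iff intro!: bexI[of _ "1 - _"])
    moreover have "((\<lambda>t::real. 1 - t) has_vector_derivative - 1) (at t within {0..1})"
      by (auto intro!: derivative_eq_intros)
    ultimately show ?thesis
      using vector_diff_chain_within[of "\<lambda>t. 1 - t" "- 1" t "{0..1}" f f'] that
      by (simp add: o_def)
  qed
  have "geodesic (add_tensor euclidean_connection (\<lambda>x y. - K x y)) ?r"
    unfolding geodesic_add_tensor_iff
  proof (intro conjI exI ballI)
    fix t :: real assume t: "t \<in> {0..1}"
    then have t': "1 - t \<in> {0..1}" by simp
    have "(?h has_vector_derivative u (1 - t)) (at t within {0..1})"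
      using has_vector_derivative_diff[OF has_vector_derivative_const rev[OF u(1)[OF t']], of "P + Q"]
      by simp
    then show "(?r has_vector_derivative u (1 - t)) (at t within {0..1})"
      by (rule has_vector_derivative_transform[OF t, rotated]) simp
    show "((\<lambda>t. u (1 - t)) has_vector_derivative - (- K (u (1 - t)) (u (1 - t)))) (at t within {0..1})"
      by (rule rev[OF u(2)[OF t']])
  qed simp
  moreover have "?r t \<in> ball (midpoint P Q) (norm (P - Q))" if t: "t \<in> {0..1}" for t
  proof -
    have "1 - t \<in> {0..1}" using t by simp
    then have "\<gamma> (1 - t) \<in> ball (midpoint P Q) (norm (P - Q))"
      using g unfolding confined_geodesic_def by blast
    moreover have "midpoint P Q - ?h t = - (midpoint P Q - \<gamma> (1 - t))"
      by (simp add: midpoint_def algebra_simps) (simp flip: scaleR_add_left add: algebra_simps)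
    ultimately show ?thesis using t by (simp only: mem_ball dist_norm norm_minus_cancel restrict_apply if_True)
  qed
  ultimately show ?thesis using g unfolding confined_geodesic_def by auto
qed

lemma bounded_bilinear_minus:
  assumes "bounded_bilinear K"
  shows "bounded_bilinear (\<lambda>x y. - K x y)"
proof -
  interpret bounded_bilinear K by (rule assms)
  obtain k where "\<And>x y. norm (K x y) \<le> norm x * norm y * k" using bounded by blast
  then show ?thesis
    by unfold_locales (auto simp: add_left add_right scaleR_left scaleR_right)
qed

lemma geodesic_midpoint_add_dual:
  fixes K :: "'a::euclidean_space \<Rightarrow> 'a \<Rightarrow> 'a"
  assumes K: "bounded_bilinear K" and bound: "\<And>x y. norm (K x y) \<le> k * norm x * norm y"
    and k: "0 \<le> k" and small: "16 * k * norm (P - Q) < 1"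
  shows "geodesic_midpoint (add_tensor euclidean_connection K) P Q
     + geodesic_midpoint (add_tensor euclidean_connection (\<lambda>x y. - K x y)) P Q = P + Q"
proof (cases "P = Q")
  case False
  let ?D = "add_tensor euclidean_connection K"
  let ?D' = "add_tensor euclidean_connection (\<lambda>x y. - K x y)"
  have K': "bounded_bilinear (\<lambda>x y. - K x y)" by (rule bounded_bilinear_minus[OF K])
  have bound': "norm (- K x y) \<le> k * norm x * norm y" for x y using bound by simp
  define \<gamma> where "\<gamma> = (THE \<gamma>. confined_geodesic ?D P Q \<gamma>)"
  have "confined_geodesic ?D P Q \<gamma>"
    unfolding \<gamma>_def by (rule theI'[OF confined_geodesic_ex1[OF K bound k small False]])
  note r = confined_geodesic_reflect[OF K this]
  have "(THE \<gamma>. confined_geodesic ?D' P Q \<gamma>) = restrict (\<lambda>t. P + Q - \<gamma> (1 - t)) {0..1}"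
    by (rule the1_equality) (rule confined_geodesic_ex1[OF K' bound' k small False], rule r)
  then show ?thesis
    using False by (simp add: geodesic_midpoint_def flip: \<gamma>_def)
qed (simp add: geodesic_midpoint_def)

section \<open>Gauss iteration of two means with \<open>A + M = P + Q\<close>\<close>

lemma gauss_iter_sum_preserving:
  fixes A M :: "'a::real_normed_vector \<Rightarrow> 'a \<Rightarrow> 'a"
  assumes sum: "\<And>p q. norm (p - q) < \<epsilon> \<Longrightarrow> A p q + M p q = p + q"
    and half: "\<And>p q. norm (p - q) < \<epsilon> \<Longrightarrow> norm (A p q - M p q) \<le> norm (p - q) / 2"
    and PQ: "norm (P - Q) < \<epsilon>" and n: "gauss_iter A M P Q n = (p, q)"
  shows "p + q = P + Q" "norm (p - q) \<le> norm (P - Q) / 2 ^ n" "norm (p - q) < \<epsilon>"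
proof -
  have "p + q = P + Q \<and> norm (p - q) \<le> norm (P - Q) / 2 ^ n \<and> norm (p - q) < \<epsilon>"
    using n
  proof (induction n arbitrary: p q)
    case (Suc n)
    obtain p' q' where pq': "gauss_iter A M P Q n = (p', q')" by fastforce
    with Suc.prems have pq: "p = A p' q'" "q = M p' q'" by auto
    note IH = Suc.IH[OF pq']
    have h: "norm (p - q) \<le> norm (p' - q') / 2" using half IH pq by blast
    also have "\<dots> \<le> norm (P - Q) / 2 ^ n / 2" using IH by (intro divide_right_mono) auto
    finally have "norm (p - q) \<le> norm (P - Q) / 2 ^ Suc n" by (simp add: mult.commute)
    moreover have "p + q = P + Q" using sum IH pq by metis
    moreover have "norm (p - q) < \<epsilon>" using h IH norm_ge_zero[of "p' - q'"] by linarith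
    ultimately show ?case by blast
  qed (use PQ in auto)
  then show "p + q = P + Q" "norm (p - q) \<le> norm (P - Q) / 2 ^ n" "norm (p - q) < \<epsilon>" by auto
qed

text \<open>Each iterate is half the preserved sum plus or minus half the vanishing gap.\<close>
lemma common_limit_of_sum_preserving:
  fixes A M :: "'a::real_normed_vector \<Rightarrow> 'a \<Rightarrow> 'a"
  assumes sum: "\<And>p q. norm (p - q) < \<epsilon> \<Longrightarrow> A p q + M p q = p + q"
    and half: "\<And>p q. norm (p - q) < \<epsilon> \<Longrightarrow> norm (A p q - M p q) \<le> norm (p - q) / 2"
    and PQ: "norm (P - Q) < \<epsilon>"
  shows "common_limit (gauss_iter A M P Q) ((1 / 2) *\<^sub>R (P + Q))"
proof -
  define d where "d n = (1 / 2) *\<^sub>R (fst (gauss_iter A M P Q n) - snd (gauss_iter A M P Q n))" for n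
  note iter = gauss_iter_sum_preserving[OF sum half PQ surjective_pairing]
  have "(\<lambda>n. norm (P - Q) / 2 * (1 / 2) ^ n) \<longlonglongrightarrow> norm (P - Q) / 2 * 0"
    by (intro tendsto_intros LIMSEQ_power_zero) simp
  then have lim: "(\<lambda>n. norm (P - Q) / 2 * (1 / 2) ^ n) \<longlonglongrightarrow> 0" by simp
  have d: "d \<longlonglongrightarrow> 0"
    by (rule Lim_null_comparison[OF _ lim])
       (use iter(2) in \<open>auto simp: d_def power_divide intro!: always_eventually\<close>)
  have sum_eq: "fst (gauss_iter A M P Q n) + snd (gauss_iter A M P Q n) = P + Q" for n
    by (rule iter(1))
  have split: "x = (1 / 2) *\<^sub>R (x + y) + (1 / 2) *\<^sub>R (x - y)"
    "y = (1 / 2) *\<^sub>R (x + y) - (1 / 2) *\<^sub>R (x - y)" for x y :: 'a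
    by (simp_all add: algebra_simps flip: scaleR_add_left)
  have "fst (gauss_iter A M P Q n) = (1 / 2) *\<^sub>R (P + Q) + d n"
    "snd (gauss_iter A M P Q n) = (1 / 2) *\<^sub>R (P + Q) - d n" for n
    unfolding d_def sum_eq[of n, symmetric] by (rule split)+
  then show ?thesis
    unfolding common_limit_def
    using tendsto_add[OF tendsto_const d] tendsto_diff[OF tendsto_const d] by simp
qed

lemma gauss_composition_eq:
  fixes P :: "'a::t2_space"
  assumes "common_limit (gauss_iter A M P Q) L"
  shows "gauss_composition A M P Q = L"
  unfolding gauss_composition_def using assms
  by (intro the_equality) (auto simp: common_limit_def intro: LIMSEQ_unique)

section \<open>Dual geodesic means and their Gauss composition\<close>

text \<open>The two midpoints are mirror images in \<open>(P + Q) / 2\<close>, so their gap is twice the distance of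
  either from it.\<close>
lemma geodesic_midpoint_gap:
  fixes K :: "'a::euclidean_space \<Rightarrow> 'a \<Rightarrow> 'a"
  assumes K: "bounded_bilinear K" and bound: "\<And>x y. norm (K x y) \<le> k * norm x * norm y"
    and k: "0 \<le> k" and small: "16 * k * norm (P - Q) < 1"
  shows "norm (geodesic_midpoint (add_tensor euclidean_connection K) P Q
      - geodesic_midpoint (add_tensor euclidean_connection (\<lambda>x y. - K x y)) P Q)
    \<le> 64 * k * (norm (P - Q))\<^sup>2" (is "norm (?A - ?M) \<le> _")
proof -
  have M: "?M = P + Q - ?A"
    using geodesic_midpoint_add_dual[OF K bound k small] by (simp add: eq_diff_eq add.commute)
  have "?A - ?M = 2 *\<^sub>R (?A - midpoint P Q)"
    unfolding M by (simp add: midpoint_def scaleR_2 algebra_simps)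
  then have "norm (?A - ?M) = 2 * norm (?A - midpoint P Q)" by simp
  then show ?thesis using geodesic_midpoint_estimate[OF K bound k small] by simp
qed

text \<open>The case \<open>K = 0\<close>, \<open>k = 0\<close> of the midpoint estimate, where the error bound vanishes.\<close>
lemma geodesic_midpoint_euclidean:
  fixes P Q :: "'a::euclidean_space"
  shows "geodesic_midpoint euclidean_connection P Q = midpoint P Q"
proof -
  have "euclidean_connection = add_tensor euclidean_connection (\<lambda>_ _. 0 :: 'a)"
    by (simp add: fun_eq_iff add_tensor_def)
  moreover have "bounded_bilinear (\<lambda>_ _. 0 :: 'a)"
    by (intro bounded_bilinear.intro exI[of _ 0]) simp_all
  ultimately show ?thesis
    using geodesic_midpoint_estimate[of "\<lambda>_ _. 0 :: 'a" 0 P Q] by simp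
qed

theorem mainTheorem8:
  fixes C :: "(real ^ 'n) \<Rightarrow> (real ^ 'n) \<Rightarrow> (real ^ 'n) \<Rightarrow> real"
    and K :: "(real ^ 'n) \<Rightarrow> (real ^ 'n) \<Rightarrow> (real ^ 'n)"
    and nabla nabla_dual :: "(real ^ 'n) connection"
    and A M :: "(real ^ 'n) \<Rightarrow> (real ^ 'n) \<Rightarrow> (real ^ 'n)"
  assumes dim: "CARD('n) \<ge> 2"
    and C: "nonzero_cubic_form C"
    and K: "represents K C"
    and nabla: "nabla = add_tensor euclidean_connection K"
    and nabla_dual: "nabla_dual = add_tensor euclidean_connection (\<lambda>X Y. - K X Y)"
    and A: "A = geodesic_midpoint nabla"
    and M: "M = geodesic_midpoint nabla_dual"
  shows
    \<comment> \<open>(i)\<close>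
    "(torsion_free nabla \<and> torsion_free nabla_dual
      \<and> metric_dual nabla nabla_dual \<and> metric_dual nabla_dual nabla
      \<and> (\<forall>D\<in>{nabla, nabla_dual}. flat D \<longleftrightarrow> (\<forall>X Y. commutator (K X) (K Y) = (\<lambda>_. 0)))
      \<and> (\<exists>(C' :: (real ^ 'n) \<Rightarrow> (real ^ 'n) \<Rightarrow> (real ^ 'n) \<Rightarrow> real) K'.
           nonzero_cubic_form C' \<and> represents K' C'
           \<and> \<not> flat (add_tensor euclidean_connection K')))
    \<and>
    \<comment> \<open>(ii)\<close>
    (\<exists>\<rho>>0. \<forall>P Q. 0 < norm (P - Q) \<and> norm (P - Q) < \<rho> \<longrightarrow>
        (\<forall>D\<in>{nabla, nabla_dual}. \<exists>!\<gamma>. confined_geodesic D P Q \<gamma>)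
        \<and> A P Q + M P Q = P + Q)
    \<and>
    \<comment> \<open>(iii)\<close>
    (\<exists>\<epsilon>>0. \<exists>c. \<forall>P Q. norm (P - Q) < \<epsilon> \<longrightarrow>
        (\<forall>n. case gauss_iter A M P Q n of (p, q) \<Rightarrow>
              geodesic_midpoint_defined nabla p q \<and> geodesic_midpoint_defined nabla_dual p q)
        \<and> (\<forall>n. case (gauss_iter A M P Q n, gauss_iter A M P Q (Suc n)) of ((p, q), (p', q')) \<Rightarrow>
              norm (p' - q') \<le> c * (norm (p - q))\<^sup>2)
        \<and> (\<exists>L. common_limit (gauss_iter A M P Q) L)
        \<and> gauss_composition A M P Q = (1 / 2) *\<^sub>R (P + Q)
        \<and> geodesic_midpoint euclidean_connection P Q = (1 / 2) *\<^sub>R (P + Q))"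
proof -
  have tri: "trilinear C" and tsym: "totally_symmetric C"
    using C by (simp_all add: nonzero_cubic_form_def)
  have bil: "bounded_bilinear K" by (rule represents_bounded_bilinear[OF K tri])
  have sym: "K x y = K y x" for x y by (rule represents_symmetric[OF K tsym])
  note bil' = bounded_bilinear_minus[OF bil]
  have adj: "K x y \<bullet> z = K x z \<bullet> y" for x y z
    using K tsym by (simp add: represents_def totally_symmetric_def)
  have comm: "commutator (\<lambda>y. - K X y) (\<lambda>y. - K Y y) = commutator (K X) (K Y)" for X Y
    by (simp add: commutator_def bounded_bilinear.minus_right[OF bil])
  obtain k where k: "0 \<le> k" and kb: "\<And>x y. norm (K x y) \<le> norm x * norm y * k"
    using bounded_bilinear.nonneg_bounded[OF bil] by blast
  have bound: "norm (K x y) \<le> k * norm x * norm y" for x y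
    using kb[of x y] by (simp add: mult_ac)
  then have bound': "norm (- K x y) \<le> k * norm x * norm y" for x y by simp
  have small: "16 * k * x < 1" "64 * k * x\<^sup>2 \<le> x / 2" if "x < 1 / (128 * (k + 1))" "0 \<le> x" for x :: real
  proof -
    have "128 * k * x + 128 * x < 1"
      using that(1) k by (simp add: field_simps)
    then have 1: "128 * (k * x) < 1" using that(2) by linarith
    then show "16 * k * x < 1" using mult_nonneg_nonneg[OF k that(2)] by linarith
    have "128 * (k * x) * x \<le> 1 * x" using 1 that(2) by (intro mult_right_mono) auto
    then show "64 * k * x\<^sup>2 \<le> x / 2" by (simp add: power2_eq_square)
  qed
  \<comment> \<open>With \<open>128k\<epsilon> < 1\<close> short geodesics exist and are unique, and the bound \<open>64k\<delta>\<^sup>2\<close> on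
    the new gap is at most \<open>\<delta> / 2\<close>, so that the iteration stays in the admissible range.\<close>
  define \<epsilon> where "\<epsilon> = 1 / (128 * (k + 1))"
  have \<epsilon>: "0 < \<epsilon>" using k by (simp add: \<epsilon>_def)
  note small = small[folded \<epsilon>_def, OF _ norm_ge_zero]

  have i: "torsion_free nabla \<and> torsion_free nabla_dual
      \<and> metric_dual nabla nabla_dual \<and> metric_dual nabla_dual nabla
      \<and> (\<forall>D\<in>{nabla, nabla_dual}. flat D \<longleftrightarrow> (\<forall>X Y. commutator (K X) (K Y) = (\<lambda>_. 0)))"
    unfolding nabla nabla_dual
    using torsion_free_add_tensor[of K] torsion_free_add_tensor[of "\<lambda>x y. - K x y"] sym
      metric_dual_add_tensor[of "\<lambda>x y. - K x y" K] metric_dual_add_tensor[of K "\<lambda>x y. - K x y"] adj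
      flat_add_tensor_iff[OF bil] flat_add_tensor_iff[OF bil'] comm
    by simp

  have ex1: "\<exists>!\<gamma>. confined_geodesic nabla P Q \<gamma>" "\<exists>!\<gamma>. confined_geodesic nabla_dual P Q \<gamma>"
    if "norm (P - Q) < \<epsilon>" "P \<noteq> Q" for P Q
    unfolding nabla nabla_dual
    by (rule confined_geodesic_ex1[OF bil bound k small(1)[OF that(1)] that(2)]
        confined_geodesic_ex1[OF bil' bound' k small(1)[OF that(1)] that(2)])+
  have sum: "A P Q + M P Q = P + Q" if "norm (P - Q) < \<epsilon>" for P Q
    unfolding A M nabla nabla_dual by (rule geodesic_midpoint_add_dual[OF bil bound k small(1)[OF that]])
  have gap: "norm (A P Q - M P Q) \<le> 64 * k * (norm (P - Q))\<^sup>2" if "norm (P - Q) < \<epsilon>" for P Q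
    unfolding A M nabla nabla_dual by (rule geodesic_midpoint_gap[OF bil bound k small(1)[OF that]])
  have half: "norm (A P Q - M P Q) \<le> norm (P - Q) / 2" if "norm (P - Q) < \<epsilon>" for P Q
    using gap[OF that] small(2)[OF that] by linarith

  have ii: "\<exists>\<rho>>0. \<forall>P Q. 0 < norm (P - Q) \<and> norm (P - Q) < \<rho> \<longrightarrow>
        (\<forall>D\<in>{nabla, nabla_dual}. \<exists>!\<gamma>. confined_geodesic D P Q \<gamma>)
        \<and> A P Q + M P Q = P + Q"
    using \<epsilon> ex1 sum by (intro exI[of _ \<epsilon>]) auto

  have "\<forall>P Q. norm (P - Q) < \<epsilon> \<longrightarrow>
        (\<forall>n. case gauss_iter A M P Q n of (p, q) \<Rightarrow>
              geodesic_midpoint_defined nabla p q \<and> geodesic_midpoint_defined nabla_dual p q)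
        \<and> (\<forall>n. case (gauss_iter A M P Q n, gauss_iter A M P Q (Suc n)) of ((p, q), (p', q')) \<Rightarrow>
              norm (p' - q') \<le> 64 * k * (norm (p - q))\<^sup>2)
        \<and> (\<exists>L. common_limit (gauss_iter A M P Q) L)
        \<and> gauss_composition A M P Q = (1 / 2) *\<^sub>R (P + Q)
        \<and> geodesic_midpoint euclidean_connection P Q = (1 / 2) *\<^sub>R (P + Q)"
  proof (intro allI impI conjI)
    fix P Q :: "real ^ 'n" and n
    assume PQ: "norm (P - Q) < \<epsilon>"
    obtain p q where pq: "gauss_iter A M P Q n = (p, q)" by fastforce
    have close: "norm (p - q) < \<epsilon>"
      by (rule gauss_iter_sum_preserving(3)[OF sum half PQ pq])
    show "case gauss_iter A M P Q n of (p, q) \<Rightarrow>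
        geodesic_midpoint_defined nabla p q \<and> geodesic_midpoint_defined nabla_dual p q"
      using ex1[OF close] by (auto simp: pq geodesic_midpoint_defined_def)
    show "case (gauss_iter A M P Q n, gauss_iter A M P Q (Suc n)) of ((p, q), (p', q')) \<Rightarrow>
        norm (p' - q') \<le> 64 * k * (norm (p - q))\<^sup>2"
      using gap[OF close] by (simp add: pq)
  next
    fix P Q :: "real ^ 'n"
    assume PQ: "norm (P - Q) < \<epsilon>"
    have lim: "common_limit (gauss_iter A M P Q) ((1 / 2) *\<^sub>R (P + Q))"
      by (rule common_limit_of_sum_preserving[OF sum half PQ])
    show "\<exists>L. common_limit (gauss_iter A M P Q) L" using lim by (rule exI)
    show "gauss_composition A M P Q = (1 / 2) *\<^sub>R (P + Q)" by (rule gauss_composition_eq[OF lim])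
    show "geodesic_midpoint euclidean_connection P Q = (1 / 2) *\<^sub>R (P + Q)"
      by (simp add: geodesic_midpoint_euclidean midpoint_def)
  qed
  with i ii exists_nonflat[OF dim] \<epsilon> show ?thesis by blast
qed

end
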